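(* Let $\operatorname{opt}_{\max}$ denote the maximality choice function induced by the credal set $\mathcal{M}$. For any consistent decision tree $T$, $$\operatorname{back}_{\operatorname{opt}_{\max}}(T)=\operatorname{norm}_{\operatorname{opt}_{\max}}(T).$$
   Context: **Uncertainty model.** $\Omega$ is a finite non-empty set (possibility space); events are subsets of $\Omega$, and $\overline{A}$ is the complement of $A$. A gamble is a function $X\colon\Omega\to\mathbb{R}$. An event also denotes its indicator, so $AX$ means $I_A X$. $\mathcal{M}$ is a (non-empty) closed convex set of probability mass functions on $\Omega$ with $p(\omega)>0$ for all $p\in\mathcal{M}$, $\omega\in\Omega$. For a non-empty event $A$ and $p\in\mathcal{M}$, $E_p(X|A)=\frac{\sum_{\omega\in A}X(\omega)p(\omega)}{\sum_{\omega\in A}p(\omega)}$, $\underline{P}(X|A)=\min_{p\in\mathcal{M}}E_p(X|A)$, $\overline{P}(X|A)=\max_{p\in\mathcal{M}}E_p(X|A)$. **Choice functions.** A choice function $\operatorname{opt}$ maps, for each non-empty event $A$, each non-empty finite set $\mathcal{X}$ of gambles to a non-empty subset $\operatorname{opt}(\mathcal{X}|A)\subseteq\mathcal{X}$. Maximality is $\operatorname{opt}_{\max}(\mathcal{X}|A)=\{X\in\mathcal{X}\colon \text{there is no }Y\in\mathcal{X}\text{ with }\underline{P}(Y-X|A)>0\}$. **Decision trees.** A decision tree is a finite rooted tree whose nodes are reward leaves (labelled by real numbers), decision nodes, and chance nodes; the arcs leaving a chance node are labelled by events forming a partition of $\Omega$. With every tree $T$ is associated an event $\operatorname{ev}(T)$,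 the intersection of all events on chance arcs that precede $T$. For a node $N$ of $T$, $\operatorname{st}_N(T)$ denotes the subtree of $T$ at $N$ (all non-descendants of $N$ removed); $\operatorname{ev}(\operatorname{st}_N(T))$ is the intersection of $\operatorname{ev}(T)$ with all events on the chance arcs on the path from the root of $T$ to $N$. $T$ is consistent if $\operatorname{ev}(\operatorname{st}_N(T))\neq\emptyset$ for every node $N$ of $T$. **Normal form decisions and gambles.** A normal form decision of $T$ is a reduced tree obtained from $T$ by keeping exactly one arc at each decision node (and discarding the parts no longer reachable); it has the same associated event $\operatorname{ev}(T)$. $\operatorname{nfd}(T)$ is the set of all of them. Each normal form decision $U$ has a gamble: a leaf with reward $r$ gives the constant gamble $r$; a decision node gives the gamble of its single remaining subtree; a chance node with events $E_1,\dots,E_n$ whose subtrees have gambles $X_1,\dots,X_n$ gives $\sum_{i=1}^n E_iX_i$. For $U\in\operatorname{nfd}(T)$, $\operatorname{gamb}(U)$ is the singleton containing its gamble; for a set $\mathcal{U}$ of normal form decisions $\operatorname{gamb}(\mathcal{U})=\bigcup_{U\in\mathcal{U}}\operatorname{gamb}(U)$; and $\operatorname{gamb}(T)=\operatorname{gamb}(\operatorname{nfd}(T))$. **The two solution operators.** For a choice function $\operatorname{opt}$ and a consistent tree $T$, $$\operatorname{norm}_{\operatorname{opt}}(T)=\{U\in\operatorname{nfd}(T)\colon\operatorname{gamb}(U)\subseteq\operatorname{opt}(\operatorname{gamb}(T)|\operatorname{ev}(T))\}.$$ The normal form backward induction operator $\operatorname{back}_{\operatorname{opt}}$ is defined recursively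 from right to left: if $T$ is a reward leaf, $\operatorname{back}_{\operatorname{opt}}(T)=\{T\}$. Otherwise, let $S(T)$ be the set of those $U\in\operatorname{nfd}(T)$ such that, for each child subtree $T_i$ of the root of $T$ that is retained in $U$ (all children if the root is a chance node, the chosen child if it is a decision node), the restriction of $U$ to $T_i$ belongs to $\operatorname{back}_{\operatorname{opt}}(T_i)$, where $T_i$ carries its event $\operatorname{ev}(T_i)$ as a subtree of $T$; then $$\operatorname{back}_{\operatorname{opt}}(T)=\{U\in S(T)\colon\operatorname{gamb}(U)\subseteq\operatorname{opt}(\operatorname{gamb}(S(T))|\operatorname{ev}(T))\}.$$ *)

theory Defs
  imports "HOL-Analysis.Analysis"
begin

text \<open>
  The possibility space is the universe of a finite type \<open>'w\<close>. Mass functions are taken in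
  \<^typ>\<open>real ^ 'w\<close>, where \<^const>\<open>closed\<close> and \<^const>\<open>convex\<close> are both available.
\<close>

type_synonym 'w event = "'w set"
type_synonym 'w gamble = "'w \<Rightarrow> real"
type_synonym 'w choice_function = "'w gamble set \<Rightarrow> 'w event \<Rightarrow> 'w gamble set"

definition credal_set :: "(real ^ 'w::finite) set \<Rightarrow> bool" where
  "credal_set M \<longleftrightarrow> M \<noteq> {} \<and> closed M \<and> convex M \<and>
     (\<forall>p\<in>M. (\<forall>\<omega>. 0 < p $ \<omega>) \<and> (\<Sum>\<omega>\<in>UNIV. p $ \<omega>) = 1)"

definition cond_exp :: "real ^ 'w::finite \<Rightarrow> 'w gamble \<Rightarrow> 'w event \<Rightarrow> real" where
  "cond_exp p X A = (\<Sum>\<omega>\<in>A. X \<omega> * p $ \<omega>) / (\<Sum>\<omega>\<in>A. p $ \<omega>)"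

text \<open>The infimum is a minimum, see \<open>lower_prevision_attained\<close> below.\<close>

definition lower_prevision :: "(real ^ 'w::finite) set \<Rightarrow> 'w gamble \<Rightarrow> 'w event \<Rightarrow> real" where
  "lower_prevision M X A = (INF p\<in>M. cond_exp p X A)"

lemma lower_prevision_attained:
  assumes M: "credal_set M" and A: "A \<noteq> {}"
  shows "\<exists>p\<in>M. cond_exp p X A = lower_prevision M X A \<and> (\<forall>q\<in>M. cond_exp p X A \<le> cond_exp q X A)"
proof -
  have pos: "0 < p $ \<omega>" and sum1: "(\<Sum>\<omega>\<in>UNIV. p $ \<omega>) = 1" if "p \<in> M" for p \<omega>
    using M that by (auto simp: credal_set_def)
  have "norm p \<le> 1" if "p \<in> M" for p
  proof -
    have "norm p \<le> (\<Sum>\<omega>\<in>UNIV. \<bar>p $ \<omega>\<bar>)"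
      by (rule norm_le_l1_cart)
    also have "\<dots> = (\<Sum>\<omega>\<in>UNIV. p $ \<omega>)"
      using pos[OF that] by (intro sum.cong) (auto simp: less_imp_le)
    finally show ?thesis
      using sum1[OF that] by simp
  qed
  then have "compact M"
    using M unfolding credal_set_def compact_eq_bounded_closed bounded_iff by blast
  moreover have "0 < (\<Sum>\<omega>\<in>A. p $ \<omega>)" if "p \<in> M" for p
    using pos[OF that] A by (intro sum_pos) auto
  then have "continuous_on M (\<lambda>p. cond_exp p X A)"
    unfolding cond_exp_def by (intro continuous_intros) (auto dest: less_imp_neq[symmetric])
  moreover have "M \<noteq> {}"
    using M by (simp add: credal_set_def)
  ultimately obtain p where p: "p \<in> M" "\<forall>q\<in>M. cond_exp p X A \<le> cond_exp q X A"
    using continuous_attains_inf by blast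
  then have "lower_prevision M X A = cond_exp p X A"
    unfolding lower_prevision_def by (intro cInf_eq_minimum) auto
  with p show ?thesis
    by auto
qed

definition opt_max :: "(real ^ 'w::finite) set \<Rightarrow> 'w choice_function" where
  "opt_max M \<X> A =
     {X \<in> \<X>. \<not> (\<exists>Y\<in>\<X>. 0 < lower_prevision M (\<lambda>\<omega>. Y \<omega> - X \<omega>) A)}"

text \<open>
  Decision arcs carry labels, so that a normal form decision records which arc was kept even when
  different children have common normal form decisions; chance arcs are identified by their
  events. The event \<open>ev(T)\<close> depends on what precedes \<open>T\<close> and not on \<open>T\<close> alone, so it is passed
  separately, as the argument \<open>A\<close> preceding the tree.
\<close>

datatype ('w, 'd) dtree =
    is_Leaf: Leaf real
  | Decision "('d \<times> ('w, 'd) dtree) list"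
  | Chance "('w event \<times> ('w, 'd) dtree) list"

inductive decision_tree :: "('w, 'd) dtree \<Rightarrow> bool" where
  "decision_tree (Leaf r)"
| "ds \<noteq> [] \<Longrightarrow> distinct (map fst ds) \<Longrightarrow> (\<forall>(d, t)\<in>set ds. decision_tree t)
    \<Longrightarrow> decision_tree (Decision ds)"
| "distinct (map fst cs) \<Longrightarrow> partition_on UNIV (fst ` set cs)
    \<Longrightarrow> (\<forall>(E, t)\<in>set cs. decision_tree t) \<Longrightarrow> decision_tree (Chance cs)"

text \<open>
  \<open>subtree_at A T B S\<close>: given \<open>ev(T) = A\<close>, there is a node \<open>N\<close> of \<open>T\<close> with \<open>st\<^sub>N(T) = S\<close> and
  \<open>ev(st\<^sub>N(T)) = B\<close>.
\<close>

inductive subtree_at :: "'w event \<Rightarrow> ('w, 'd) dtree \<Rightarrow> 'w event \<Rightarrow> ('w, 'd) dtree \<Rightarrow> bool"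
  for A T where
  "subtree_at A T A T"
| "subtree_at A T B (Decision ds) \<Longrightarrow> (d, t) \<in> set ds \<Longrightarrow> subtree_at A T B t"
| "subtree_at A T B (Chance cs) \<Longrightarrow> (E, t) \<in> set cs \<Longrightarrow> subtree_at A T (B \<inter> E) t"

definition consistent :: "'w event \<Rightarrow> ('w, 'd) dtree \<Rightarrow> bool" where
  "consistent A T \<longleftrightarrow> (\<forall>B S. subtree_at A T B S \<longrightarrow> B \<noteq> {})"

fun nfd :: "('w, 'd) dtree \<Rightarrow> ('w, 'd) dtree set" where
  "nfd (Leaf r) = {Leaf r}"
| "nfd (Decision ds) = (\<Union>(d, t)\<in>set ds. {Decision [(d, u)] |u. u \<in> nfd t})"
| "nfd (Chance cs) =
     {Chance (zip (map fst cs) us) |us. us \<in> listset (map (\<lambda>(E, t). nfd t) cs)}"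

text \<open>Only meaningful for normal form decisions, whose decision nodes have exactly one arc.\<close>

fun gamble_of :: "('w, 'd) dtree \<Rightarrow> 'w gamble" where
  "gamble_of (Leaf r) = (\<lambda>\<omega>. r)"
| "gamble_of (Decision [(d, u)]) = gamble_of u"
| "gamble_of (Decision _) = undefined"
| "gamble_of (Chance cs) = (\<lambda>\<omega>. \<Sum>(E, u)\<leftarrow>cs. indicator E \<omega> * gamble_of u \<omega>)"

definition gamb :: "('w, 'd) dtree set \<Rightarrow> 'w gamble set" where
  "gamb \<U> = (\<Union>U\<in>\<U>. {gamble_of U})"

definition norm_opt ::
    "'w choice_function \<Rightarrow> 'w event \<Rightarrow> ('w, 'd) dtree \<Rightarrow> ('w, 'd) dtree set" where
  "norm_opt opt A T = {U \<in> nfd T. gamb {U} \<subseteq> opt (gamb (nfd T)) A}"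

text \<open>
  For \<open>U \<in> nfd T\<close>, the triples \<open>(B, t, u)\<close> of a child subtree \<open>t\<close> of the root of \<open>T\<close> that is
  retained in \<open>U\<close>, its event \<open>B = ev(t)\<close>, and the restriction \<open>u\<close> of \<open>U\<close> to \<open>t\<close>.
\<close>

fun retained :: "'w event \<Rightarrow> ('w, 'd) dtree \<Rightarrow> ('w, 'd) dtree
    \<Rightarrow> ('w event \<times> ('w, 'd) dtree \<times> ('w, 'd) dtree) set" where
  "retained A (Decision ds) (Decision us) =
     {(A, t, u) |d t u. (d, t) \<in> set ds \<and> (d, u) \<in> set us}"
| "retained A (Chance cs) (Chance us) =
     {(A \<inter> E, t, u) |E t u. (E, t) \<in> set cs \<and> (E, u) \<in> set us}"
| "retained A _ _ = {}"

lemma size_retained: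
  assumes "(B, t, u) \<in> retained A T U"
  shows "size t < size T"
proof -
  have sz: "size t < Suc (size_list (size_prod (\<lambda>_. 0) size) xs)"
    if "(c, t) \<in> set xs" for c :: 'c and t :: "('a, 'b) dtree" and xs
    using size_list_estimation[OF that, of "size t" "size_prod (\<lambda>_. 0) size"]
    by simp
  show ?thesis
    using assms by (cases "(A, T, U)" rule: retained.cases) (auto dest: sz)
qed

function back_opt ::
    "'w choice_function \<Rightarrow> 'w event \<Rightarrow> ('w, 'd) dtree \<Rightarrow> ('w, 'd) dtree set" where
  "back_opt opt A T =
    (if is_Leaf T then {T}
     else let S = {U \<in> nfd T. \<forall>B t u. (B, t, u) \<in> retained A T U \<longrightarrow> u \<in> back_opt opt B t}
       in {U \<in> S. gamb {U} \<subseteq> opt (gamb S) A})"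
  by pat_completeness auto
termination
  by (relation "Wellfounded.measure (\<lambda>(opt, A, T). size T)") (auto dest: size_retained)

declare back_opt.simps [simp del]

end

theory Submission imports Defs begin

text \<open>
  Maximality selects the maximal elements of a strict partial order on gambles. In a finite
  strict order, if \<open>S\<close> contains all maximal elements of \<open>N \<supseteq> S\<close>, then \<open>S\<close> and \<open>N\<close> have the same
  maximal elements. It therefore suffices that every restriction of a maximal normal form decision
  to a child subtree is itself maximal there: otherwise, replace it by a dominating one. At a
  chance arc \<open>E\<close> this changes the gamble only on \<open>E\<close>, and so produces a gamble that dominates the
  original one given \<open>A\<close>, as only the part of the sum over \<open>A \<inter> E\<close> is affected.
\<close>

text \<open>Unnormalised form of a positive lower prevision of \<open>Y - X\<close> given
  \<open>A\<close>: the factor \<open>p(A)\<close> is cleared, so sums over \<open>A\<close> can be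
  added and restricted to sub-events.\<close>

definition dominates :: "(real ^ 'w::finite) set \<Rightarrow> 'w event \<Rightarrow> 'w gamble \<Rightarrow> 'w gamble \<Rightarrow> bool" where
  "dominates M A Y X \<longleftrightarrow> (\<forall>p\<in>M. 0 < (\<Sum>\<omega>\<in>A. (Y \<omega> - X \<omega>) * p $ \<omega>))"

lemma lower_prevision_pos_iff:
  assumes M: "credal_set M"
  shows "0 < lower_prevision M X A \<longleftrightarrow> (\<forall>p\<in>M. 0 < (\<Sum>\<omega>\<in>A. X \<omega> * p $ \<omega>))"
proof (cases "A = {}")
  case True
  then show ?thesis
    \<comment> \<open>Both sides are false here: the sum is empty, and \<open>0 / 0 = 0\<close>
      makes the infimum over the non-empty \<open>M\<close> equal to 0.\<close>
    using M by (auto simp: lower_prevision_def cond_exp_def credal_set_def)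
next
  case False
  have "0 < (\<Sum>\<omega>\<in>A. p $ \<omega>)" if "p \<in> M" for p
    using M that False by (intro sum_pos) (auto simp: credal_set_def)
  then have "0 < cond_exp p X A \<longleftrightarrow> 0 < (\<Sum>\<omega>\<in>A. X \<omega> * p $ \<omega>)" if "p \<in> M" for p
    using that by (simp add: cond_exp_def zero_less_divide_iff) (meson not_less_iff_gr_or_eq)
  moreover have "0 < lower_prevision M X A \<longleftrightarrow> (\<forall>p\<in>M. 0 < cond_exp p X A)"
    \<comment> \<open>An attained infimum of positive values is positive.\<close>
    using lower_prevision_attained[OF M False, of X] by fastforce
  ultimately show ?thesis
    by simp
qed

lemma dominates_trans: "dominates M A Z X" if "dominates M A Z Y" "dominates M A Y X"
  unfolding dominates_def
proof
  fix p assume "p \<in> M"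
  then have "0 < (\<Sum>\<omega>\<in>A. (Z \<omega> - Y \<omega>) * p $ \<omega>) + (\<Sum>\<omega>\<in>A. (Y \<omega> - X \<omega>) * p $ \<omega>)"
    using that by (auto simp: dominates_def intro: add_pos_pos)
  then show "0 < (\<Sum>\<omega>\<in>A. (Z \<omega> - X \<omega>) * p $ \<omega>)"
    by (simp add: sum.distrib[symmetric] algebra_simps)
qed

lemma not_dominates_self: "credal_set M \<Longrightarrow> \<not> dominates M A X X"
  by (auto simp: dominates_def credal_set_def)

lemma mem_opt_max_iff:
  assumes "credal_set M"
  shows "X \<in> opt_max M \<X> A \<longleftrightarrow> X \<in> \<X> \<and> (\<forall>Y\<in>\<X>. \<not> dominates M A Y X)"
  using assms by (auto simp: opt_max_def lower_prevision_pos_iff dominates_def)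

text \<open>Among the finitely many gambles that dominate \<open>X\<close>, take an undominated one.
  Anything in \<X> dominating it would dominate \<open>X\<close> too, by transitivity, so it is
  maximal in all of \<X>.\<close>

lemma dominated_by_maximal:
  assumes M: "credal_set M" and "finite \<X>" and "Y \<in> \<X>" and "dominates M A Y X"
  shows "\<exists>Z\<in>opt_max M \<X> A. dominates M A Z X"
proof -
  let ?D = "{Z \<in> \<X>. dominates M A Z X}"
  have "asymp_on ?D (\<lambda>Y Z. dominates M A Z Y)" "transp_on ?D (\<lambda>Y Z. dominates M A Z Y)"
    using dominates_trans not_dominates_self[OF M] by (blast intro: asymp_onI transp_onI)+
  then obtain Z where "Z \<in> ?D" "\<forall>Y\<in>?D. Y \<noteq> Z \<longrightarrow> \<not> dominates M A Y Z"
    using Finite_Set.bex_max_element[of ?D "\<lambda>Y Z. dominates M A Z Y"] assms by auto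
  then have "Z \<in> opt_max M \<X> A"
    using dominates_trans[of M A _ Z X] not_dominates_self[OF M, of A Z]
    unfolding mem_opt_max_iff[OF M] mem_Collect_eq Ball_def by metis
  with \<open>Z \<in> ?D\<close> show ?thesis
    by blast
qed

text \<open>If some element of \<Y> dominates \<open>X\<close>, so does a maximal one, and that one
  lies in \<X>. Hence being undominated in \<X> already means being undominated in \<Y>.\<close>

lemma opt_max_eq_if_subset:
  assumes M: "credal_set M" and "finite \<Y>" and "\<X> \<subseteq> \<Y>" and sub: "opt_max M \<Y> A \<subseteq> \<X>"
  shows "opt_max M \<X> A = opt_max M \<Y> A"
proof
  show "opt_max M \<X> A \<subseteq> opt_max M \<Y> A"
  proof
    fix X assume "X \<in> opt_max M \<X> A"
    then show "X \<in> opt_max M \<Y> A"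
      using dominated_by_maximal[OF M \<open>finite \<Y>\<close>, of _ A X] sub \<open>\<X> \<subseteq> \<Y>\<close>
      unfolding mem_opt_max_iff[OF M] by blast
  qed
  show "opt_max M \<Y> A \<subseteq> opt_max M \<X> A"
    using sub \<open>\<X> \<subseteq> \<Y>\<close> unfolding mem_opt_max_iff[OF M] subset_iff by blast
qed

lemma gamb_eq: "gamb \<U> = gamble_of ` \<U>"
  by (auto simp: gamb_def)

lemma mem_norm_opt_max_iff:
  assumes "credal_set M"
  shows "U \<in> norm_opt (opt_max M) A T \<longleftrightarrow>
    U \<in> nfd T \<and> (\<forall>V\<in>nfd T. \<not> dominates M A (gamble_of V) (gamble_of U))"
  using assms by (auto simp: norm_opt_def gamb_eq mem_opt_max_iff)

lemma listset_iff: "xs \<in> listset As \<longleftrightarrow> list_all2 (\<in>) xs As"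
  by (induction As arbitrary: xs) (auto simp: set_Cons_def list_all2_Cons2)

lemma finite_listset: "\<forall>A\<in>set As. finite A \<Longrightarrow> finite (listset As)"
proof (induction As)
  case (Cons A As)
  have "set_Cons A (listset As) = (\<lambda>(x, xs). x # xs) ` (A \<times> listset As)"
    by (auto simp: set_Cons_def)
  with Cons show ?case
    by simp
qed simp

text \<open>Aligning the arcs by position allows the decision on a single arc to be exchanged by a
  list update.\<close>

lemma mem_nfd_Chance_iff:
  "U \<in> nfd (Chance cs) \<longleftrightarrow>
    (\<exists>us. U = Chance us \<and> list_all2 (\<lambda>(E, u) (F, t). E = F \<and> u \<in> nfd t) us cs)"
proof
  assume "U \<in> nfd (Chance cs)"
  then show "\<exists>us. U = Chance us \<and> list_all2 (\<lambda>(E, u) (F, t). E = F \<and> u \<in> nfd t) us cs"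
    by (auto simp: listset_iff list_all2_conv_all_nth split_beta)
next
  assume "\<exists>us. U = Chance us \<and> list_all2 (\<lambda>(E, u) (F, t). E = F \<and> u \<in> nfd t) us cs"
  then obtain us where U: "U = Chance us" and
    us: "list_all2 (\<lambda>(E, u) (F, t). E = F \<and> u \<in> nfd t) us cs"
    by blast
  have "map fst us = map fst cs"
    using us by (auto simp: list_all2_conv_all_nth split_beta intro!: nth_equalityI)
  then have "us = zip (map fst cs) (map snd us)"
    by (metis zip_map_fst_snd)
  moreover have "map snd us \<in> listset (map (\<lambda>(E, t). nfd t) cs)"
    using us by (auto simp: listset_iff list_all2_conv_all_nth split_beta)
  ultimately show "U \<in> nfd (Chance cs)"
    using U by auto
qed

lemma finite_nfd: "finite (nfd T)"
  by (induction T rule: nfd.induct) (auto intro!: finite_listset finite_imageI simp: setcompr_eq_image)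

lemma gamble_of_Chance_update:
  assumes "i < length us" and "us ! i = (E, u)"
  shows "gamble_of (Chance (us[i := (E, v)])) \<omega> - gamble_of (Chance us) \<omega> =
    indicator E \<omega> * (gamble_of v \<omega> - gamble_of u \<omega>)"
  using assms
  by (induction us arbitrary: i) (auto simp: nth_Cons algebra_simps split: nat.splits)

text \<open>The indicator of \<open>E\<close> turns the sum over \<open>A\<close> into the sum over
  \<open>A \<inter> E\<close>, so the two dominance conditions are the same inequality for each
  \<open>p\<close>.\<close>

lemma dominates_Chance_update:
  assumes "i < length us" and "us ! i = (E, u)"
    and "dominates M (A \<inter> E) (gamble_of v) (gamble_of u)"
  shows "dominates M A (gamble_of (Chance (us[i := (E, v)]))) (gamble_of (Chance us))"
  using assms(3)
  by (simp add: dominates_def gamble_of_Chance_update[OF assms(1,2)] mult.assoc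
      sum.inter_restrict indicator_def if_distrib cong: if_cong del: gamble_of.simps)

lemma decision_tree_retained:
  assumes T: "decision_tree T" and "(B, t, u) \<in> retained A T U"
  shows "decision_tree t"
  using T
proof cases
  case (2 ds)
  with assms(2) show ?thesis
    by (cases U) auto
next
  case (3 cs)
  with assms(2) show ?thesis
    by (cases U) auto
qed (use assms(2) in simp)

lemma norm_opt_retained:
  assumes M: "credal_set M" and T: "decision_tree T"
    and U: "U \<in> norm_opt (opt_max M) A T" and ret: "(B, t, u) \<in> retained A T U"
  shows "u \<in> norm_opt (opt_max M) B t"
proof -
  \<comment> \<open>Contrapositive form: a decision that beats \<open>u\<close> in the child lifts
    to one that beats \<open>U\<close> in \<open>T\<close>.\<close>
  have "u \<in> nfd t \<and> (\<forall>v\<in>nfd t. dominates M B (gamble_of v) (gamble_of u) \<longrightarrow>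
    (\<exists>V\<in>nfd T. dominates M A (gamble_of V) (gamble_of U)))"
  proof (cases T)
    case (Leaf r)
    with ret show ?thesis by simp
  next
    case (Decision ds)
    then have dist: "distinct (map fst ds)"
      using T by (auto elim: decision_tree.cases)
    obtain d t' u' where "(d, t') \<in> set ds" "u' \<in> nfd t'" "U = Decision [(d, u')]"
      using U Decision by (auto simp: mem_norm_opt_max_iff[OF M])
    moreover from this have "(d, t) \<in> set ds" "u = u'" "B = A"
      using ret Decision by auto
    \<comment> \<open>\<open>retained\<close> pairs children by label; distinct labels ensure that
      \<open>t\<close> is the child from which \<open>u\<close> was taken.\<close>
    moreover from calculation have "t = t'"
      using dist eq_key_imp_eq_value by metis
    moreover from calculation have "Decision [(d, v)] \<in> nfd T" if "v \<in> nfd t" for v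
      using Decision that by auto
    \<comment> \<open>A decision node passes on both the event and the gamble of its chosen child,
      so dominance carries over unchanged.\<close>
    ultimately show ?thesis
      by (metis gamble_of.simps(2))
  next
    case (Chance cs)
    then have dist: "distinct (map fst cs)"
      using T by (auto elim: decision_tree.cases)
    obtain us where Us: "U = Chance us" and
      us: "list_all2 (\<lambda>(E, u) (F, t). E = F \<and> u \<in> nfd t) us cs"
      using U Chance by (auto simp: mem_norm_opt_max_iff[OF M] mem_nfd_Chance_iff simp del: nfd.simps)
    obtain E where B: "B = A \<inter> E" and Et: "(E, t) \<in> set cs" and Eu: "(E, u) \<in> set us"
      using ret Chance Us by auto
    obtain i where i: "i < length us" "us ! i = (E, u)"
      using Eu by (auto simp: in_set_conv_nth)
    have "i < length cs" "fst (cs ! i) = E" "u \<in> nfd (snd (cs ! i))"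
      using us i by (auto simp: list_all2_conv_all_nth split_beta)
    \<comment> \<open>\<open>retained\<close> matches arcs by event, \<open>nfd\<close> by position;
      distinct events reconcile the two.\<close>
    then have "cs ! i = (E, t)"
      using Et dist by (metis eq_key_imp_eq_value nth_mem prod.collapse)
    moreover from this have "u \<in> nfd t"
      using \<open>u \<in> nfd (snd (cs ! i))\<close> by simp
    moreover have "Chance (us[i := (E, v)]) \<in> nfd T" if "v \<in> nfd t" for v
      using us i that \<open>cs ! i = (E, t)\<close> unfolding Chance mem_nfd_Chance_iff
      by (auto simp: list_all2_conv_all_nth nth_list_update)
    ultimately show ?thesis
      using dominates_Chance_update[OF i] Us B by blast
  qed
  with U show ?thesis
    unfolding mem_norm_opt_max_iff[OF M] by blast
qed

text \<open>Induction step: optimality passes to retained children, so \<open>S\<close> keeps every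
  optimal decision, and discarding the others leaves the optimal gambles unchanged.\<close>

lemma back_opt_eq_norm_opt:
  assumes M: "credal_set M" and T: "decision_tree T" and "\<not> is_Leaf T"
    and IH: "\<And>B t U u. (B, t, u) \<in> retained A T U \<Longrightarrow>
      back_opt (opt_max M) B t = norm_opt (opt_max M) B t"
  shows "back_opt (opt_max M) A T = norm_opt (opt_max M) A T"
proof -
  define S where
    "S = {U \<in> nfd T. \<forall>B t u. (B, t, u) \<in> retained A T U \<longrightarrow> u \<in> back_opt (opt_max M) B t}"
  have norm_S: "norm_opt (opt_max M) A T \<subseteq> S"
  proof
    fix U assume U: "U \<in> norm_opt (opt_max M) A T"
    then have "u \<in> back_opt (opt_max M) B t" if "(B, t, u) \<in> retained A T U" for B t u
      using norm_opt_retained[OF M T U that] IH[OF that] by simp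
    with U show "U \<in> S"
      unfolding S_def norm_opt_def by blast
  qed
  have "opt_max M (gamb S) A = opt_max M (gamb (nfd T)) A"
  proof (rule opt_max_eq_if_subset[OF M])
    show "finite (gamb (nfd T))"
      by (simp add: gamb_eq finite_nfd)
    show "gamb S \<subseteq> gamb (nfd T)"
      by (auto simp: gamb_eq S_def)
    show "opt_max M (gamb (nfd T)) A \<subseteq> gamb S"
    proof
      fix X assume X: "X \<in> opt_max M (gamb (nfd T)) A"
      then obtain U where "U \<in> nfd T" "X = gamble_of U"
        by (auto simp: opt_max_def gamb_eq)
      \<comment> \<open>Membership in \<open>norm_opt\<close> depends on a decision only through its
        gamble, so any \<open>U\<close> realising \<open>X\<close> qualifies.\<close>
      with X have "U \<in> norm_opt (opt_max M) A T"
        by (simp add: norm_opt_def gamb_eq)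
      then show "X \<in> gamb S"
        using norm_S \<open>X = gamble_of U\<close> by (auto simp: gamb_eq)
    qed
  qed
  moreover have "back_opt (opt_max M) A T = {U \<in> S. gamb {U} \<subseteq> opt_max M (gamb S) A}"
    using \<open>\<not> is_Leaf T\<close> by (subst back_opt.simps) (simp add: S_def Let_def)
  ultimately show ?thesis
    using norm_S by (auto simp: norm_opt_def S_def)
qed

theorem corollary18:
  fixes M :: "(real ^ 'w::finite) set"
    and A :: "'w event"
    and T :: "('w, 'd) dtree"
  assumes "credal_set M"
    and "decision_tree T"
    and "consistent A T"
  shows "back_opt (opt_max M) A T = norm_opt (opt_max M) A T"
  using assms(2)
\<comment> \<open>The event varies because a child of a chance node carries
  \<open>A \<inter> E\<close>.\<close>
proof (induction T arbitrary: A rule: measure_induct_rule[of size])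
  case (less T)
  note M = assms(1)
  show ?case
  proof (cases "is_Leaf T")
    case True
    then show ?thesis
      using not_dominates_self[OF M]
      by (cases T) (auto simp: back_opt.simps mem_norm_opt_max_iff[OF M])
  next
    case False
    show ?thesis
    proof (rule back_opt_eq_norm_opt[OF M less.prems False])
      fix B t U u assume "(B, t, u) \<in> retained A T U"
      then show "back_opt (opt_max M) B t = norm_opt (opt_max M) B t"
        using less.IH less.prems size_retained decision_tree_retained by blast
    qed
  qed
qed

end
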